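(* Let $R$ be an integral domain and $c\in R$ a non-zero, non-invertible element. If $D$ is a positive link diagram (i.e. a diagram with only positive crossings), then $k_c(D)=0$.
   Context: Links and diagrams are oriented. Let $A=R[X]/(X^2-cX)$ be the Frobenius algebra with its usual multiplication $m$ and unit, counit $\epsilon(1)=0,\epsilon(X)=1$, and comultiplication $\Delta(1)=X\otimes1+1\otimes X-c\,1\otimes1$, $\Delta(X)=X\otimes X$. For a diagram $D$ with $n^-$ negative crossings, a state $s$ is a choice of 0- or 1-resolution at each crossing (convention: the orientation preserving resolution of a positive crossing is its 0-resolution, that of a negative crossing is its 1-resolution); $|s|$ is the number of 1-resolutions, and $V(D,s)=A^{\otimes r(D,s)}$ has one tensor factor for each of the $r(D,s)$ circles. The complex $C_c(D;R)$ is the usual Khovanov cube complex built from $A$: $\bigoplus_{|s|=i}V(D,s)$ in homological degree $i-n^-$, differential the usual signed sum of maps induced by $m$ (merging circles) or $\Delta$ (splitting a circle). $H_c(D;R)$ is its homology, and $H_c(D;R)_f$ is the quotient of $H_c(D;R)$ by its torsion submodule. (This is the member $(h,t)=(c,0)$ of the family built from $R[X]/(X^2-hX-t)$; any other $(h,t)$ with $h^2+4t=c^2$ and $(h\pm c)/2\in R$ gives a canonically isomorphic homology with the classes below corresponding.) Put $\mathbf a=X$, $\mathbf b=X-c$. Let $s$ be the orientation preserving state of $D$, whose circles are the Seifert circles. Color the regions of the plane cut out by the Seifert circles in checkerboard fashion with the unbounded region white; color a Seifert circle $\mathbf a$ if it has a black region on its left, otherwise $\mathbf b$. The tensor product of these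 colors is a cycle $\alpha(D)\in V(D,s)$. For an element $z$ of an $R$-module $M$ put $k_c(z)=\max\{k\ge0: z\in c^kM\}\in[0,\infty]$. Define $k_c(D)=k_c([\alpha(D)])$ with $[\alpha(D)]\in H_c(D;R)_f$. *)

theory Defs
  imports "HOL-Algebra.Algebra" "HOL-Library.Extended_Nat"
begin

section \<open>Modules\<close>

text \<open>
  A module record extends a ring record, but the predicate \<open>module\<close> only looks at the additive
  structure and at scalar multiplication; the multiplicative fields are left undefined.
\<close>

definition free_module :: "('r, 'm) ring_scheme \<Rightarrow> 'g set \<Rightarrow> ('r, 'g \<Rightarrow> 'r) module" where
  "free_module R S =
    \<lparr>carrier = S \<rightarrow>\<^sub>E carrier R, monoid.mult = undefined, one = undefined,
     ring.zero = (\<lambda>g\<in>S. \<zero>\<^bsub>R\<^esub>), ring.add = (\<lambda>x y. \<lambda>g\<in>S. x g \<oplus>\<^bsub>R\<^esub> y g),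
     smult = (\<lambda>a x. \<lambda>g\<in>S. a \<otimes>\<^bsub>R\<^esub> x g)\<rparr>"

text \<open>The quotient of a module by a submodule \<open>N\<close>; its elements are the cosets of \<open>N\<close>.\<close>

definition quot_module :: "('r, 'b) module \<Rightarrow> 'b set \<Rightarrow> ('r, 'b set) module" where
  "quot_module M N =
    \<lparr>carrier = a_rcosets\<^bsub>M\<^esub> N, monoid.mult = undefined, one = undefined,
     ring.zero = N, ring.add = (\<lambda>K L. K <+>\<^bsub>M\<^esub> L),
     smult = (\<lambda>a K. \<Union>x\<in>K. N +>\<^bsub>M\<^esub> (a \<odot>\<^bsub>M\<^esub> x))\<rparr>"

definition direct_sum_module :: "('i \<Rightarrow> ('r, 'b) module) \<Rightarrow> ('r, 'i \<Rightarrow> 'b) module" where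
  "direct_sum_module M =
    \<lparr>carrier = {h. (\<forall>i. h i \<in> carrier (M i)) \<and> finite {i. h i \<noteq> \<zero>\<^bsub>M i\<^esub>}},
     monoid.mult = undefined, one = undefined,
     ring.zero = (\<lambda>i. \<zero>\<^bsub>M i\<^esub>), ring.add = (\<lambda>g h i. g i \<oplus>\<^bsub>M i\<^esub> h i),
     smult = (\<lambda>a h i. a \<odot>\<^bsub>M i\<^esub> h i)\<rparr>"

definition torsion_submodule :: "('r, 'm) ring_scheme \<Rightarrow> ('r, 'b) module \<Rightarrow> 'b set" where
  "torsion_submodule R M =
    {z \<in> carrier M. \<exists>r \<in> carrier R - {\<zero>\<^bsub>R\<^esub>}. r \<odot>\<^bsub>M\<^esub> z = \<zero>\<^bsub>M\<^esub>}"

definition divisibility ::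
    "('r, 'm) ring_scheme \<Rightarrow> ('r, 'b) module \<Rightarrow> 'r \<Rightarrow> 'b \<Rightarrow> enat" where
  "divisibility R M c z =
    Sup {enat k | k. z \<in> (\<lambda>y. (c [^]\<^bsub>R\<^esub> k) \<odot>\<^bsub>M\<^esub> y) ` carrier M}"


section \<open>Oriented link diagrams in the plane\<close>

text \<open>
  A diagram is given by its underlying planar 4-valent map, up to isotopy of the plane. Look at a
  crossing with both strands pointing upwards: the edge ends at its four corners are \<open>in_left\<close>
  (bottom left), \<open>in_right\<close> (bottom right), \<open>out_left\<close> (top left) and \<open>out_right\<close> (top right).
  One strand runs from \<open>in_left\<close> to \<open>out_right\<close>, the other one from \<open>in_right\<close> to \<open>out_left\<close>;
  the crossing is positive iff the former is the overstrand.
\<close>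

record 'e crossing =
  in_left :: 'e
  in_right :: 'e
  out_left :: 'e
  out_right :: 'e
  positive :: bool

text \<open>
  The crossings are listed in the order that is used for the signs in the cube complex. The faces
  are the connected components of the complement of the diagram; every edge has a face to its left
  and one to its right. An edge that does not occur at any crossing is a circle without crossings.
  Since faces are part of the data, the relative position of the pieces of a split diagram
  is recorded.
\<close>

record ('e, 'f) diagram =
  crossings :: "'e crossing list"
  edges :: "'e set"
  faces :: "'f set"
  left_face :: "'e \<Rightarrow> 'f"
  right_face :: "'e \<Rightarrow> 'f"
  unbounded_face :: 'f

definition incoming :: "'e crossing \<Rightarrow> 'e list" where
  "incoming x = [in_left x, in_right x]"

definition outgoing :: "'e crossing \<Rightarrow> 'e list" where
  "outgoing x = [out_left x, out_right x]"

definition equiv_closure :: "('a \<times> 'a) set \<Rightarrow> ('a \<times> 'a) set" where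
  "equiv_closure r = (r \<union> r\<inverse>)\<^sup>*"

text \<open>The connected components of the plane curve underlying the diagram.\<close>

definition shadow_components :: "('e, 'f) diagram \<Rightarrow> 'e set set" where
  "shadow_components D =
    edges D // equiv_closure
      (\<Union>x \<in> set (crossings D).
         set (incoming x @ outgoing x) \<times> set (incoming x @ outgoing x))"

text \<open>
  The four equations between faces say that the sides of the edges fit together in the four corners
  of a crossing. The last two conditions are planarity: the faces are connected to each other across
  edges, and Euler's formula holds. There are twice as many edge pieces as crossings, apart from
  the circles without crossings, which do not contribute to the Euler characteristic, so
  \<open>V - E + F = 1 + C\<close> becomes \<open>F = V + C + 1\<close>.
\<close>

definition link_diagram :: "('e, 'f) diagram \<Rightarrow> bool" where
  "link_diagram D \<longleftrightarrow>
     finite (edges D) \<and> finite (faces D) \<and>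
     distinct (concat (map incoming (crossings D))) \<and>
     distinct (concat (map outgoing (crossings D))) \<and>
     set (concat (map incoming (crossings D))) = set (concat (map outgoing (crossings D))) \<and>
     set (concat (map incoming (crossings D))) \<subseteq> edges D \<and>
     left_face D ` edges D \<subseteq> faces D \<and>
     right_face D ` edges D \<subseteq> faces D \<and>
     unbounded_face D \<in> faces D \<and>
     (\<forall>x \<in> set (crossings D).
        left_face D (in_left x) = left_face D (out_left x) \<and>
        right_face D (in_right x) = right_face D (out_right x) \<and>
        right_face D (in_left x) = left_face D (in_right x) \<and>
        right_face D (out_left x) = left_face D (out_right x)) \<and>
     (\<forall>f \<in> faces D. (unbounded_face D, f) \<in>
        equiv_closure {(left_face D e, right_face D e) | e. e \<in> edges D}) \<and>
     card (faces D) = length (crossings D) + card (shadow_components D) + 1"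

definition positive_diagram :: "('e, 'f) diagram \<Rightarrow> bool" where
  "positive_diagram D \<longleftrightarrow> (\<forall>x \<in> set (crossings D). positive x)"

definition n_minus :: "('e, 'f) diagram \<Rightarrow> nat" where
  "n_minus D = card {k. k < length (crossings D) \<and> \<not> positive (crossings D ! k)}"


section \<open>States and their circles\<close>

text \<open>
  A state is represented by the set of (indices of) crossings at which the 1-resolution is chosen.
  The orientation preserving resolution joins the incoming to the outgoing end on the same side.
\<close>

definition states :: "('e, 'f) diagram \<Rightarrow> nat set set" where
  "states D = Pow {..<length (crossings D)}"

definition resolution_joins :: "'e crossing \<Rightarrow> bool \<Rightarrow> ('e \<times> 'e) set" where
  "resolution_joins x one_resolution =
    (if one_resolution \<longleftrightarrow> \<not> positive x
     then {(in_left x, out_left x), (in_right x, out_right x)}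
     else {(in_left x, in_right x), (out_left x, out_right x)})"

definition same_circle :: "('e, 'f) diagram \<Rightarrow> nat set \<Rightarrow> ('e \<times> 'e) set" where
  "same_circle D s =
    equiv_closure (\<Union>k<length (crossings D). resolution_joins (crossings D ! k) (k \<in> s))"

definition circle_of :: "('e, 'f) diagram \<Rightarrow> nat set \<Rightarrow> 'e \<Rightarrow> 'e set" where
  "circle_of D s e = same_circle D s `` {e}"

definition circles :: "('e, 'f) diagram \<Rightarrow> nat set \<Rightarrow> 'e set set" where
  "circles D s = edges D // same_circle D s"

definition oriented_state :: "('e, 'f) diagram \<Rightarrow> nat set" where
  "oriented_state D = {k. k < length (crossings D) \<and> \<not> positive (crossings D ! k)}"


section \<open>The Frobenius algebra and the cube complex\<close>

text \<open>
  The algebra \<open>A = R[X]/(X\<^sup>2 - cX)\<close> is the free \<open>R\<close>-module with basis \<open>1, X\<close>, and elements of \<open>A\<close>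
  are represented by their coordinate functions. \<open>mult_coeff R c p q r\<close> is the coefficient of
  \<open>r\<close> in the product \<open>p q\<close>, and \<open>comult_coeff R c p q r\<close> is the coefficient of \<open>q \<otimes> r\<close> in the
  coproduct of \<open>p\<close>.
\<close>

datatype basis = BOne | BX

fun mult_coeff :: "('r, 'm) ring_scheme \<Rightarrow> 'r \<Rightarrow> basis \<Rightarrow> basis \<Rightarrow> basis \<Rightarrow> 'r" where
  "mult_coeff R c BOne q r = (if r = q then \<one>\<^bsub>R\<^esub> else \<zero>\<^bsub>R\<^esub>)"
| "mult_coeff R c BX BOne r = (if r = BX then \<one>\<^bsub>R\<^esub> else \<zero>\<^bsub>R\<^esub>)"
| "mult_coeff R c BX BX r = (if r = BX then c else \<zero>\<^bsub>R\<^esub>)"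

fun comult_coeff :: "('r, 'm) ring_scheme \<Rightarrow> 'r \<Rightarrow> basis \<Rightarrow> basis \<Rightarrow> basis \<Rightarrow> 'r" where
  "comult_coeff R c BOne BX BOne = \<one>\<^bsub>R\<^esub>"
| "comult_coeff R c BOne BOne BX = \<one>\<^bsub>R\<^esub>"
| "comult_coeff R c BOne BOne BOne = \<ominus>\<^bsub>R\<^esub> c"
| "comult_coeff R c BOne BX BX = \<zero>\<^bsub>R\<^esub>"
| "comult_coeff R c BX q r = (if q = BX \<and> r = BX then \<one>\<^bsub>R\<^esub> else \<zero>\<^bsub>R\<^esub>)"

text \<open>
  A labelling of the circles of a state by \<open>1\<close> and \<open>X\<close> stands for the tensor product of the labels;
  these tensors form a basis of \<open>V(D,s) = A\<^bsup>\<otimes>r(D,s)\<^esup>\<close>.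
\<close>

definition labellings :: "('e, 'f) diagram \<Rightarrow> nat set \<Rightarrow> ('e set \<Rightarrow> basis) set" where
  "labellings D s = circles D s \<rightarrow>\<^sub>E UNIV"

definition generators ::
    "('e, 'f) diagram \<Rightarrow> int \<Rightarrow> (nat set \<times> ('e set \<Rightarrow> basis)) set" where
  "generators D i =
    (SIGMA s : {s \<in> states D. int (card s) - int (n_minus D) = i}. labellings D s)"

definition chain_module ::
    "('r, 'm) ring_scheme \<Rightarrow> ('e, 'f) diagram \<Rightarrow> int
      \<Rightarrow> ('r, nat set \<times> ('e set \<Rightarrow> basis) \<Rightarrow> 'r) module" where
  "chain_module R D i = free_module R (generators D i)"

text \<open>
  The matrix coefficient from the labelling \<open>u\<close> of \<open>s\<close> to the labelling \<open>v\<close> of \<open>s \<union> {k}\<close>. The ends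
  \<open>in_left\<close> and \<open>out_right\<close> of a crossing lie on different arcs of either resolution. So the
  circles involved are those through these two ends, before and after the change of resolution,
  and two circles are merged iff they are different before the change.
\<close>

definition edge_coeff ::
    "('r, 'm) ring_scheme \<Rightarrow> 'r \<Rightarrow> ('e, 'f) diagram \<Rightarrow> nat set \<Rightarrow> nat
      \<Rightarrow> ('e set \<Rightarrow> basis) \<Rightarrow> ('e set \<Rightarrow> basis) \<Rightarrow> 'r" where
  "edge_coeff R c D s k u v =
    (let x = crossings D ! k;
         P = circle_of D s (in_left x);
         Q = circle_of D s (out_right x);
         P' = circle_of D (insert k s) (in_left x);
         Q' = circle_of D (insert k s) (out_right x)
     in if \<forall>K \<in> circles D s - {P, Q}. v K = u K
        then (if P \<noteq> Q then mult_coeff R c (u P) (u Q) (v P')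
              else comult_coeff R c (u P) (v P') (v Q'))
        else \<zero>\<^bsub>R\<^esub>)"

definition edge_sign :: "('r, 'm) ring_scheme \<Rightarrow> nat set \<Rightarrow> nat \<Rightarrow> 'r" where
  "edge_sign R s k = (\<ominus>\<^bsub>R\<^esub> \<one>\<^bsub>R\<^esub>) [^]\<^bsub>R\<^esub> card {j \<in> s. j < k}"

text \<open>The differential from degree \<open>i\<close> to degree \<open>i + 1\<close>.\<close>

definition differential ::
    "('r, 'm) ring_scheme \<Rightarrow> 'r \<Rightarrow> ('e, 'f) diagram \<Rightarrow> int
      \<Rightarrow> (nat set \<times> ('e set \<Rightarrow> basis) \<Rightarrow> 'r) \<Rightarrow> (nat set \<times> ('e set \<Rightarrow> basis) \<Rightarrow> 'r)" where
  "differential R c D i z =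
    (\<lambda>(t, v) \<in> generators D (i + 1).
       \<Oplus>\<^bsub>R\<^esub>k\<in>t. edge_sign R (t - {k}) k \<otimes>\<^bsub>R\<^esub>
         (\<Oplus>\<^bsub>R\<^esub>u\<in>labellings D (t - {k}). edge_coeff R c D (t - {k}) k u v \<otimes>\<^bsub>R\<^esub> z (t - {k}, u)))"

definition cycles ::
    "('r, 'm) ring_scheme \<Rightarrow> 'r \<Rightarrow> ('e, 'f) diagram \<Rightarrow> int
      \<Rightarrow> (nat set \<times> ('e set \<Rightarrow> basis) \<Rightarrow> 'r) set" where
  "cycles R c D i =
    a_kernel (chain_module R D i) (chain_module R D (i + 1)) (differential R c D i)"

definition boundaries ::
    "('r, 'm) ring_scheme \<Rightarrow> 'r \<Rightarrow> ('e, 'f) diagram \<Rightarrow> int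
      \<Rightarrow> (nat set \<times> ('e set \<Rightarrow> basis) \<Rightarrow> 'r) set" where
  "boundaries R c D i = differential R c D (i - 1) ` carrier (chain_module R D (i - 1))"

definition homology_degree ::
    "('r, 'm) ring_scheme \<Rightarrow> 'r \<Rightarrow> ('e, 'f) diagram \<Rightarrow> int
      \<Rightarrow> ('r, (nat set \<times> ('e set \<Rightarrow> basis) \<Rightarrow> 'r) set) module" where
  "homology_degree R c D i =
    quot_module ((chain_module R D i)\<lparr>carrier := cycles R c D i\<rparr>) (boundaries R c D i)"

definition homology ::
    "('r, 'm) ring_scheme \<Rightarrow> 'r \<Rightarrow> ('e, 'f) diagram
      \<Rightarrow> ('r, int \<Rightarrow> (nat set \<times> ('e set \<Rightarrow> basis) \<Rightarrow> 'r) set) module" where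
  "homology R c D = direct_sum_module (homology_degree R c D)"

definition homology_free ::
    "('r, 'm) ring_scheme \<Rightarrow> 'r \<Rightarrow> ('e, 'f) diagram
      \<Rightarrow> ('r, (int \<Rightarrow> (nat set \<times> ('e set \<Rightarrow> basis) \<Rightarrow> 'r) set) set) module" where
  "homology_free R c D =
    quot_module (homology R c D) (torsion_submodule R (homology R c D))"


section \<open>The class of the checkerboard colored Seifert circles\<close>

text \<open>
  The regions cut out by the Seifert circles arise from the faces of the diagram: the orientation
  preserving resolution of a crossing connects the face below it with the face above it and keeps
  the faces to its left and to its right apart.
\<close>

definition seifert_region :: "('e, 'f) diagram \<Rightarrow> 'f \<Rightarrow> 'f set" where
  "seifert_region D f =
    equiv_closure {(right_face D (in_left x), right_face D (out_left x)) | x.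
      x \<in> set (crossings D)} `` {f}"

text \<open>The checkerboard coloring is unique on the regions of a link diagram; \<open>True\<close> is black.\<close>

definition checkerboard :: "('e, 'f) diagram \<Rightarrow> ('f set \<Rightarrow> bool) \<Rightarrow> bool" where
  "checkerboard D \<chi> \<longleftrightarrow>
    (\<forall>e \<in> edges D. \<chi> (seifert_region D (left_face D e)) \<noteq> \<chi> (seifert_region D (right_face D e))) \<and>
    \<not> \<chi> (seifert_region D (unbounded_face D))"

definition black_region :: "('e, 'f) diagram \<Rightarrow> 'f set \<Rightarrow> bool" where
  "black_region D r \<longleftrightarrow> (\<exists>\<chi>. checkerboard D \<chi> \<and> \<chi> r)"

fun color_a :: "('r, 'm) ring_scheme \<Rightarrow> 'r \<Rightarrow> basis \<Rightarrow> 'r" where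
  "color_a R c BOne = \<zero>\<^bsub>R\<^esub>"
| "color_a R c BX = \<one>\<^bsub>R\<^esub>"

fun color_b :: "('r, 'm) ring_scheme \<Rightarrow> 'r \<Rightarrow> basis \<Rightarrow> 'r" where
  "color_b R c BOne = \<ominus>\<^bsub>R\<^esub> c"
| "color_b R c BX = \<one>\<^bsub>R\<^esub>"

definition seifert_color ::
    "('r, 'm) ring_scheme \<Rightarrow> 'r \<Rightarrow> ('e, 'f) diagram \<Rightarrow> 'e set \<Rightarrow> basis \<Rightarrow> 'r" where
  "seifert_color R c D K =
    (if \<exists>e\<in>K. black_region D (seifert_region D (left_face D e))
     then color_a R c else color_b R c)"

text \<open>The oriented state has \<open>n_minus D\<close> 1-resolutions, so the tensor product of the colors
  lies in degree 0.\<close>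

definition alpha ::
    "('r, 'm) ring_scheme \<Rightarrow> 'r \<Rightarrow> ('e, 'f) diagram
      \<Rightarrow> (nat set \<times> ('e set \<Rightarrow> basis) \<Rightarrow> 'r)" where
  "alpha R c D =
    (\<lambda>(s, u) \<in> generators D 0.
       if s = oriented_state D
       then \<Otimes>\<^bsub>R\<^esub>K\<in>circles D s. seifert_color R c D K (u K)
       else \<zero>\<^bsub>R\<^esub>)"

definition alpha_class ::
    "('r, 'm) ring_scheme \<Rightarrow> 'r \<Rightarrow> ('e, 'f) diagram
      \<Rightarrow> (int \<Rightarrow> (nat set \<times> ('e set \<Rightarrow> basis) \<Rightarrow> 'r) set)" where
  "alpha_class R c D =
    (\<lambda>i. if i = 0 then boundaries R c D 0 +>\<^bsub>chain_module R D 0\<^esub> alpha R c D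
         else \<zero>\<^bsub>homology_degree R c D i\<^esub>)"

definition k_invariant :: "('r, 'm) ring_scheme \<Rightarrow> 'r \<Rightarrow> ('e, 'f) diagram \<Rightarrow> enat" where
  "k_invariant R c D =
    divisibility R (homology_free R c D) c
      (torsion_submodule R (homology R c D) +>\<^bsub>homology R c D\<^esub> alpha_class R c D)"

end

theory Submission
  imports Defs
begin

text \<open>
  A positive diagram has the oriented state \<open>{}\<close>, so \<open>[\<alpha>(D)]\<close> lives in the lowest homological
  degree. There are no boundaries there, and the homology is a submodule of the free module
  \<open>V(D,{})\<close>; in particular it is torsion-free. If \<open>[\<alpha>(D)]\<close> were divisible by \<open>c\<close>, then so would be
  every coordinate of \<open>\<alpha>(D)\<close>. But the coefficient of \<open>X \<otimes> \<dots> \<otimes> X\<close> is \<open>1\<close>, because \<open>X\<close> has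
  coefficient \<open>1\<close> in both \<open>\<a> = X\<close> and \<open>\<b> = X - c\<close>.
\<close>

section \<open>Free modules, sums and images of linear maps\<close>

lemma (in cring) free_module_is_module: "module R (free_module R S)"
proof (rule moduleI)
  show "abelian_group (free_module R S)"
  proof (rule abelian_groupI)
    fix x assume x: "x \<in> carrier (free_module R S)"
    show "\<exists>y\<in>carrier (free_module R S). y \<oplus>\<^bsub>free_module R S\<^esub> x = \<zero>\<^bsub>free_module R S\<^esub>"
      using x by (intro bexI[of _ "\<lambda>g\<in>S. \<ominus> x g"])
        (auto simp: free_module_def fun_eq_iff PiE_iff l_neg)
  qed (auto simp: free_module_def fun_eq_iff PiE_iff extensional_def a_ac)
qed (auto simp: free_module_def fun_eq_iff PiE_iff extensional_def l_distr r_distr m_assoc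
      intro: is_cring)

text \<open>For finite \<open>A\<close> this is distributivity; for infinite \<open>A\<close> both
  sums take the default value zero.\<close>

lemma (in cring) finsum_mult_right:
  assumes "a \<in> carrier R" and "f \<in> A \<rightarrow> carrier R"
  shows "(\<Oplus>i\<in>A. a \<otimes> f i) = a \<otimes> (\<Oplus>i\<in>A. f i)"
  using assms by (cases "finite A") (simp_all add: finsum_rdistr finsum_infinite)

text \<open>Compatibility with scalars also handles zero and negatives: zero is zero times zero, and
  a negative is a multiple by minus one. Applied to the differential, this makes the boundaries a
  submodule.\<close>

lemma (in module) submodule_image:
  assumes "module R N"
    and closed: "\<And>x. x \<in> carrier M \<Longrightarrow> f x \<in> carrier N"
    and add: "\<And>x y. x \<in> carrier M \<Longrightarrow> y \<in> carrier M \<Longrightarrow> f (x \<oplus>\<^bsub>M\<^esub> y) = f x \<oplus>\<^bsub>N\<^esub> f y"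
    and smult: "\<And>a x. a \<in> carrier R \<Longrightarrow> x \<in> carrier M \<Longrightarrow> f (a \<odot>\<^bsub>M\<^esub> x) = a \<odot>\<^bsub>N\<^esub> f x"
  shows "submodule (f ` carrier M) R N"
proof -
  interpret N: module R N by fact
  have zero: "f \<zero>\<^bsub>M\<^esub> = \<zero>\<^bsub>N\<^esub>"
    using smult[of \<zero> "\<zero>\<^bsub>M\<^esub>"] closed[of "\<zero>\<^bsub>M\<^esub>"] by simp
  have "\<ominus>\<^bsub>N\<^esub> f x \<in> f ` carrier M" if "x \<in> carrier M" for x
  proof -
    have "\<ominus>\<^bsub>N\<^esub> f x = (\<ominus> \<one>) \<odot>\<^bsub>N\<^esub> f x"
      using that closed by (simp add: N.smult_l_minus)
    then show ?thesis using that by (simp flip: smult)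
  qed
  then show ?thesis
    using closed zero by (intro N.submoduleI) (auto simp flip: add smult intro: rev_image_eqI)
qed

section \<open>Cosets in quotient modules, and torsion\<close>

lemma quot_module_zero_closed:
  assumes "module R M" and "submodule N R M" and "\<zero>\<^bsub>M\<^esub> \<in> C"
  shows "\<zero>\<^bsub>quot_module (M\<lparr>carrier := C\<rparr>) N\<^esub> \<in> carrier (quot_module (M\<lparr>carrier := C\<rparr>) N)"
proof -
  interpret module R M by fact
  \<comment> \<open>The zero of the quotient is \<open>N\<close> itself, which has to be exhibited
    as the coset of an element of \<open>C\<close>.\<close>
  have "N +>\<^bsub>M\<lparr>carrier := C\<rparr>\<^esub> \<zero>\<^bsub>M\<^esub> = N"
    using submoduleE(1)[OF assms(2)] by (auto simp: a_r_coset_def' subset_iff)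
  then show ?thesis
    using assms(3) by (auto simp: quot_module_def A_RCOSETS_def')
qed

lemma quot_module_smult_zero:
  assumes "module R M" and "submodule N R M" and "a \<in> carrier R"
  shows "a \<odot>\<^bsub>quot_module (M\<lparr>carrier := C\<rparr>) N\<^esub> \<zero>\<^bsub>quot_module (M\<lparr>carrier := C\<rparr>) N\<^esub> =
    \<zero>\<^bsub>quot_module (M\<lparr>carrier := C\<rparr>) N\<^esub>"
proof -
  interpret module R M by fact
  note sub = submoduleE[OF assms(2)]
  have "\<zero>\<^bsub>M\<^esub> \<in> N"
    using assms(2) subgroup.one_closed[of N "add_monoid M"] by (simp add: submodule_def)
  \<comment> \<open>Every \<open>n\<close> in \<open>N\<close> is reached by taking \<open>x\<close>
    to be zero; the other inclusion is closure of \<open>N\<close>.\<close>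
  then have "n = n \<oplus>\<^bsub>M\<^esub> a \<odot>\<^bsub>M\<^esub> \<zero>\<^bsub>M\<^esub> \<and> \<zero>\<^bsub>M\<^esub> \<in> N" if "n \<in> N" for n
    using sub(1) that assms(3) by auto
  then have "(\<Union>x\<in>N. \<Union>n\<in>N. {n \<oplus>\<^bsub>M\<^esub> a \<odot>\<^bsub>M\<^esub> x}) = N"
    using sub(4,5) assms(3) by blast
  then show ?thesis
    by (simp add: quot_module_def a_r_coset_def')
qed

text \<open>Cosets of the zero submodule are singletons, so computations in \<open>Q\<close> are
  computations with representatives. Homology in degree 0 has this form for a positive
  diagram.\<close>

lemma quot_module_by_zero:
  assumes "module R M" and "C \<subseteq> carrier M"
  defines "Q \<equiv> quot_module (M\<lparr>carrier := C\<rparr>) {\<zero>\<^bsub>M\<^esub>}"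
  shows "K \<in> carrier Q \<Longrightarrow> \<exists>z\<in>C. K = {z}"
    and "{z} \<oplus>\<^bsub>Q\<^esub> {w} = {z \<oplus>\<^bsub>M\<^esub> w}"
    and "a \<in> carrier R \<Longrightarrow> z \<in> carrier M \<Longrightarrow> a \<odot>\<^bsub>Q\<^esub> {z} = {a \<odot>\<^bsub>M\<^esub> z}"
    and "\<zero>\<^bsub>Q\<^esub> = {\<zero>\<^bsub>M\<^esub>}"
proof -
  interpret module R M by fact
  show "K \<in> carrier Q \<Longrightarrow> \<exists>z\<in>C. K = {z}"
    using assms(2) by (force simp: Q_def quot_module_def A_RCOSETS_def' a_r_coset_def')
qed (use assms in \<open>auto simp: Q_def quot_module_def a_r_coset_def' set_add_def'
      module_def abelian_group_def abelian_monoid.l_zero module.smult_closed[OF assms(1)]\<close>)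

text \<open>The scalar one, nonzero in a domain, witnesses torsion. The conditions on the summands
  stand in for a proof that the direct sum is a module.\<close>

lemma zero_in_torsion_direct_sum:
  assumes "domain R" and "\<And>i. \<zero>\<^bsub>M i\<^esub> \<in> carrier (M i)"
    and "\<And>i. \<one>\<^bsub>R\<^esub> \<odot>\<^bsub>M i\<^esub> \<zero>\<^bsub>M i\<^esub> = \<zero>\<^bsub>M i\<^esub>"
  shows "\<zero>\<^bsub>direct_sum_module M\<^esub> \<in> torsion_submodule R (direct_sum_module M)"
proof -
  interpret domain R by fact
  show ?thesis
    using assms(2,3)
    by (auto simp: torsion_submodule_def direct_sum_module_def intro!: bexI[of _ "\<one>\<^bsub>R\<^esub>"])
qed

section \<open>Linearity of the differential, and the boundaries in degree 0\<close>

context cring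
begin

lemma edge_coeff_closed:
  assumes "c \<in> carrier R"
  shows "edge_coeff R c D s k u v \<in> carrier R"
proof -
  have "mult_coeff R c p q r \<in> carrier R" for p q r
    using assms by (cases p; cases q) auto
  moreover have "comult_coeff R c p q r \<in> carrier R" for p q r
    using assms by (cases p; cases q; cases r) auto
  ultimately show ?thesis
    by (simp add: edge_coeff_def Let_def)
qed

lemma edge_sign_closed: "edge_sign R s k \<in> carrier R"
  by (simp add: edge_sign_def)

lemma chain_module_is_module: "module R (chain_module R D i)"
  unfolding chain_module_def by (rule free_module_is_module)

text \<open>Chains are extensional, so their values are meaningful only on generators of their
  degree. The arguments \<open>(t - {k}, u)\<close> in \<open>differential\<close> qualify, since
  dropping a 1-resolution lowers the degree by one.\<close>

lemma generators_remove:
  assumes "(t, v) \<in> generators D (i + 1)" and "k \<in> t" and "u \<in> labellings D (t - {k})"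
  shows "(t - {k}, u) \<in> generators D i"
proof -
  have "finite t"
    using assms(1) by (auto simp: generators_def states_def intro: finite_subset)
  then have "card t = Suc (card (t - {k}))"
    using assms(2) by (metis card.remove)
  then show ?thesis
    using assms by (auto simp: generators_def states_def)
qed

lemma chain_apply_closed:
  assumes "z \<in> carrier (chain_module R D i)" and "g \<in> generators D i"
  shows "z g \<in> carrier R"
  using assms by (auto simp: chain_module_def free_module_def)

lemma differential_summand_closed:
  assumes "c \<in> carrier R" and "z \<in> carrier (chain_module R D i)"
    and "(t, v) \<in> generators D (i + 1)" and "k \<in> t"
  shows "(\<lambda>u. edge_coeff R c D (t - {k}) k u v \<otimes> z (t - {k}, u))
    \<in> labellings D (t - {k}) \<rightarrow> carrier R"
  using edge_coeff_closed[OF assms(1)]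
    chain_apply_closed[OF assms(2) generators_remove[OF assms(3,4)]] by (intro funcsetI m_closed)

lemma differential_inner_closed:
  assumes "c \<in> carrier R" and "z \<in> carrier (chain_module R D i)"
    and "(t, v) \<in> generators D (i + 1)" and "k \<in> t"
  shows "(\<Oplus>u\<in>labellings D (t - {k}). edge_coeff R c D (t - {k}) k u v \<otimes> z (t - {k}, u))
    \<in> carrier R"
  using differential_summand_closed[OF assms] by (rule finsum_closed)

lemma differential_closed:
  assumes "c \<in> carrier R" and "z \<in> carrier (chain_module R D i)"
  shows "differential R c D i z \<in> carrier (chain_module R D (i + 1))"
proof -
  have "(\<Oplus>k\<in>t. edge_sign R (t - {k}) k \<otimes> (\<Oplus>u\<in>labellings D (t - {k}).
      edge_coeff R c D (t - {k}) k u v \<otimes> z (t - {k}, u))) \<in> carrier R"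
    if "(t, v) \<in> generators D (i + 1)" for t v
    by (rule finsum_closed, rule funcsetI)
      (rule m_closed[OF edge_sign_closed differential_inner_closed[OF assms that]])
  then show ?thesis
    by (auto simp: chain_module_def[of _ _ "i + 1"] free_module_def differential_def)
qed

text \<open>Each entry of the image is a double sum; additivity passes first through the inner sum
  over labellings, then through the signed sum over \<open>k\<close>.\<close>

lemma differential_add:
  assumes "c \<in> carrier R" and z: "z \<in> carrier (chain_module R D i)"
    and w: "w \<in> carrier (chain_module R D i)"
  shows "differential R c D i (z \<oplus>\<^bsub>chain_module R D i\<^esub> w) =
    differential R c D i z \<oplus>\<^bsub>chain_module R D (i + 1)\<^esub> differential R c D i w"
proof -
  let ?f = "\<lambda>z t v k. \<Oplus>u\<in>labellings D (t - {k}).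
    edge_coeff R c D (t - {k}) k u v \<otimes> z (t - {k}, u)"
  have "(\<Oplus>k\<in>t. edge_sign R (t - {k}) k \<otimes> ?f (z \<oplus>\<^bsub>chain_module R D i\<^esub> w) t v k) =
    (\<Oplus>k\<in>t. edge_sign R (t - {k}) k \<otimes> ?f z t v k) \<oplus>
    (\<Oplus>k\<in>t. edge_sign R (t - {k}) k \<otimes> ?f w t v k)"
    if g: "(t, v) \<in> generators D (i + 1)" for t v
  proof -
    note closed = differential_summand_closed[OF assms(1) z g]
      differential_summand_closed[OF assms(1) w g]
    note inner = differential_inner_closed[OF assms(1) z g]
      differential_inner_closed[OF assms(1) w g]
    have "?f (z \<oplus>\<^bsub>chain_module R D i\<^esub> w) t v k = ?f z t v k \<oplus> ?f w t v k" if "k \<in> t" for k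
    proof -
      have "?f (z \<oplus>\<^bsub>chain_module R D i\<^esub> w) t v k = (\<Oplus>u\<in>labellings D (t - {k}).
          edge_coeff R c D (t - {k}) k u v \<otimes> z (t - {k}, u) \<oplus>
          edge_coeff R c D (t - {k}) k u v \<otimes> w (t - {k}, u))"
      proof (rule finsum_cong')
        fix u assume "u \<in> labellings D (t - {k})"
        then have u: "(t - {k}, u) \<in> generators D i"
          using g that by (intro generators_remove)
        then have "(z \<oplus>\<^bsub>chain_module R D i\<^esub> w) (t - {k}, u) =
            z (t - {k}, u) \<oplus> w (t - {k}, u)"
          by (simp add: chain_module_def free_module_def)
        then show "edge_coeff R c D (t - {k}) k u v \<otimes>
              (z \<oplus>\<^bsub>chain_module R D i\<^esub> w) (t - {k}, u) =
            edge_coeff R c D (t - {k}) k u v \<otimes> z (t - {k}, u) \<oplus>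
            edge_coeff R c D (t - {k}) k u v \<otimes> w (t - {k}, u)"
          using chain_apply_closed[OF z u] chain_apply_closed[OF w u]
          by (simp add: r_distr edge_coeff_closed assms(1))
      qed (use closed[OF that] in auto)
      then show ?thesis
        using closed[OF that] by (simp add: finsum_addf)
    qed
    then have "(\<Oplus>k\<in>t. edge_sign R (t - {k}) k \<otimes> ?f (z \<oplus>\<^bsub>chain_module R D i\<^esub> w) t v k) =
      (\<Oplus>k\<in>t. edge_sign R (t - {k}) k \<otimes> ?f z t v k \<oplus>
        edge_sign R (t - {k}) k \<otimes> ?f w t v k)"
      using inner by (intro finsum_cong') (auto simp: r_distr edge_sign_closed)
    also have "\<dots> = (\<Oplus>k\<in>t. edge_sign R (t - {k}) k \<otimes> ?f z t v k) \<oplus>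
      (\<Oplus>k\<in>t. edge_sign R (t - {k}) k \<otimes> ?f w t v k)"
      using inner by (intro finsum_addf) (auto simp: edge_sign_closed)
    finally show ?thesis .
  qed
  then show ?thesis
    by (auto simp: differential_def chain_module_def[of _ _ "i + 1"] free_module_def
        fun_eq_iff)
qed

text \<open>Commutativity moves \<open>a\<close> past the edge coefficient and then past the sign,
  and \<open>finsum_mult_right\<close> pulls it out of each sum.\<close>

lemma differential_smult:
  assumes "c \<in> carrier R" and a: "a \<in> carrier R" and z: "z \<in> carrier (chain_module R D i)"
  shows "differential R c D i (a \<odot>\<^bsub>chain_module R D i\<^esub> z) =
    a \<odot>\<^bsub>chain_module R D (i + 1)\<^esub> differential R c D i z"
proof -
  let ?f = "\<lambda>z t v k. \<Oplus>u\<in>labellings D (t - {k}).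
    edge_coeff R c D (t - {k}) k u v \<otimes> z (t - {k}, u)"
  have "(\<Oplus>k\<in>t. edge_sign R (t - {k}) k \<otimes> ?f (a \<odot>\<^bsub>chain_module R D i\<^esub> z) t v k) =
    a \<otimes> (\<Oplus>k\<in>t. edge_sign R (t - {k}) k \<otimes> ?f z t v k)"
    if g: "(t, v) \<in> generators D (i + 1)" for t v
  proof -
    note closed = differential_summand_closed[OF assms(1) z g]
    note inner = differential_inner_closed[OF assms(1) z g]
    have "?f (a \<odot>\<^bsub>chain_module R D i\<^esub> z) t v k = a \<otimes> ?f z t v k" if "k \<in> t" for k
    proof -
      have "?f (a \<odot>\<^bsub>chain_module R D i\<^esub> z) t v k = (\<Oplus>u\<in>labellings D (t - {k}).
          a \<otimes> (edge_coeff R c D (t - {k}) k u v \<otimes> z (t - {k}, u)))"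
      proof (rule finsum_cong')
        fix u assume "u \<in> labellings D (t - {k})"
        then have u: "(t - {k}, u) \<in> generators D i"
          using g that by (intro generators_remove)
        then have "(a \<odot>\<^bsub>chain_module R D i\<^esub> z) (t - {k}, u) = a \<otimes> z (t - {k}, u)"
          by (simp add: chain_module_def free_module_def)
        then show "edge_coeff R c D (t - {k}) k u v \<otimes>
              (a \<odot>\<^bsub>chain_module R D i\<^esub> z) (t - {k}, u) =
            a \<otimes> (edge_coeff R c D (t - {k}) k u v \<otimes> z (t - {k}, u))"
          using chain_apply_closed[OF z u] a by (simp add: m_lcomm edge_coeff_closed assms(1))
      qed (use closed[OF that] a in auto)
      then show ?thesis
        using closed[OF that] a by (simp add: finsum_mult_right)
    qed
    then have "(\<Oplus>k\<in>t. edge_sign R (t - {k}) k \<otimes> ?f (a \<odot>\<^bsub>chain_module R D i\<^esub> z) t v k) =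
      (\<Oplus>k\<in>t. a \<otimes> (edge_sign R (t - {k}) k \<otimes> ?f z t v k))"
      using inner a by (intro finsum_cong') (auto simp: m_lcomm edge_sign_closed)
    also have "\<dots> = a \<otimes> (\<Oplus>k\<in>t. edge_sign R (t - {k}) k \<otimes> ?f z t v k)"
      using inner a by (intro finsum_mult_right) (auto simp: edge_sign_closed)
    finally show ?thesis .
  qed
  then show ?thesis
    by (auto simp: differential_def chain_module_def[of _ _ "i + 1"] free_module_def
        fun_eq_iff)
qed

text \<open>Boundaries are the image of the linear map leaving degree \<open>i - 1\<close>;
  simplification identifies \<open>i - 1 + 1\<close> with \<open>i\<close>.\<close>

lemma boundaries_submodule:
  assumes "c \<in> carrier R"
  shows "submodule (boundaries R c D i) R (chain_module R D i)"
  using module.submodule_image[OF chain_module_is_module[of D "i - 1"]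
      chain_module_is_module[of D i], of "differential R c D (i - 1)"]
    differential_closed[OF assms, of _ D "i - 1"] differential_add[OF assms, of _ D "i - 1"]
    differential_smult[OF assms, of _ _ D "i - 1"]
  by (simp add: boundaries_def)

lemma zero_in_cycles:
  assumes "c \<in> carrier R"
  shows "\<zero>\<^bsub>chain_module R D i\<^esub> \<in> cycles R c D i"
proof -
  interpret M: module R "chain_module R D i" by (rule chain_module_is_module)
  interpret N: module R "chain_module R D (i + 1)" by (rule chain_module_is_module)
  have "differential R c D i \<zero>\<^bsub>chain_module R D i\<^esub> = \<zero>\<^bsub>chain_module R D (i + 1)\<^esub>"
    using differential_smult[OF assms zero_closed M.zero_closed]
      differential_closed[OF assms M.zero_closed] by simp
  then show ?thesis
    by (simp add: cycles_def a_kernel_def kernel_def)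
qed

text \<open>Without negative crossings the degree of a state is its number of 1-resolutions, so
  degree -1 has no generators.\<close>

lemma boundaries_zero_positive:
  assumes "c \<in> carrier R" and "positive_diagram D"
  shows "boundaries R c D 0 = {\<zero>\<^bsub>chain_module R D 0\<^esub>}"
proof -
  have "n_minus D = 0"
    using assms(2) by (auto simp: n_minus_def positive_diagram_def)
  then have "generators D (- 1) = {}"
    by (auto simp: generators_def)
  \<comment> \<open>The extensional function space over the empty set still has one element, so
    there is exactly one boundary.\<close>
  then have "carrier (chain_module R D (- 1)) = {\<lambda>_. undefined}"
    by (simp add: chain_module_def free_module_def)
  then have "boundaries R c D 0 = {differential R c D (- 1) (\<lambda>_. undefined)}"
    by (simp add: boundaries_def)
  \<comment> \<open>A submodule contains zero, which identifies the single boundary without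
    evaluating the differential.\<close>
  then show ?thesis
    using boundaries_submodule[OF assms(1), of D 0]
      subgroup.one_closed[of "boundaries R c D 0" "add_monoid (chain_module R D 0)"]
    by (auto simp: submodule_def)
qed

lemma homology_zero_in_torsion:
  assumes "domain R" and "c \<in> carrier R"
  shows "\<zero>\<^bsub>homology R c D\<^esub> \<in> torsion_submodule R (homology R c D)"
  unfolding homology_def homology_degree_def
  by (intro zero_in_torsion_direct_sum[OF assms(1)]
      quot_module_zero_closed[OF chain_module_is_module boundaries_submodule[OF assms(2)]
        zero_in_cycles[OF assms(2)]]
      quot_module_smult_zero[OF chain_module_is_module boundaries_submodule[OF assms(2)]
        one_closed])

section \<open>Coordinates of the chain \<open>alpha\<close>\<close>

lemma seifert_color_closed: "c \<in> carrier R \<Longrightarrow> seifert_color R c D K p \<in> carrier R"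
  by (cases p) (auto simp: seifert_color_def)

lemma alpha_closed: "c \<in> carrier R \<Longrightarrow> alpha R c D \<in> carrier (chain_module R D 0)"
  by (auto simp: alpha_def chain_module_def free_module_def seifert_color_closed
      intro!: finprod_closed)

text \<open>Both branches of \<open>seifert_color\<close> give \<open>\<one>\<close> at
  \<open>BX\<close>, so every factor of the product is \<open>\<one>\<close>.\<close>

lemma alpha_all_X:
  "(oriented_state D, u) \<in> generators D 0 \<Longrightarrow> (\<And>K. K \<in> circles D (oriented_state D) \<Longrightarrow> u K = BX)
    \<Longrightarrow> alpha R c D (oriented_state D, u) = \<one>"
  by (auto simp: alpha_def seifert_color_def intro!: finprod_one_eqI)

end

section \<open>Non-divisibility of the class of \<open>alpha\<close>\<close>

theorem proposition2:
  fixes R :: "('r, 'm) ring_scheme" and c :: 'r and D :: "('e, 'f) diagram"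
  assumes "domain R"
    and "c \<in> carrier R" and "c \<noteq> \<zero>\<^bsub>R\<^esub>" and "c \<notin> Units R"
    and "link_diagram D" and "positive_diagram D"
  shows "k_invariant R c D = 0"
proof -
  interpret domain R by fact
  let ?C = "chain_module R D 0"
  let ?Q = "homology_degree R c D 0"
  let ?H = "homology R c D"
  let ?T = "torsion_submodule R ?H"
  interpret C: module R ?C by (rule chain_module_is_module)
  note bound = boundaries_zero_positive[OF assms(2,6)]
  have Z: "cycles R c D 0 \<subseteq> carrier ?C"
    by (auto simp: cycles_def a_kernel_def kernel_def)
  \<comment> \<open>With only the zero boundary, elements of \<open>?Q\<close> are singletons
    \<open>{z}\<close> and can be treated as chains.\<close>
  have "?Q = quot_module (?C\<lparr>carrier := cycles R c D 0\<rparr>) {\<zero>\<^bsub>?C\<^esub>}"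
    by (simp add: homology_degree_def bound)
  note Q = quot_module_by_zero[OF C.module_axioms Z, folded this]
  let ?X = "(oriented_state D, \<lambda>K\<in>circles D (oriented_state D). BX)"
  have X: "?X \<in> generators D 0"
    by (auto simp: generators_def labellings_def oriented_state_def states_def n_minus_def)
  have apply_smult: "(a \<odot>\<^bsub>?C\<^esub> z) g = a \<otimes>\<^bsub>R\<^esub> z g"
    if "g \<in> generators D 0" for a z g
    using that by (simp add: chain_module_def free_module_def)
  \<comment> \<open>\<open>?T\<close> is formed in the whole homology, so only the degree 0
    component is claimed to vanish. It is a chain killed by a nonzero \<open>r\<close>, and its
    coordinates lie in a domain.\<close>
  have torsion: "h 0 = {\<zero>\<^bsub>?C\<^esub>}" if h_torsion: "h \<in> ?T" for h
  proof -
    obtain r where r: "r \<in> carrier R" "r \<noteq> \<zero>\<^bsub>R\<^esub>" and h: "h \<in> carrier ?H"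
      and rh: "r \<odot>\<^bsub>?H\<^esub> h = \<zero>\<^bsub>?H\<^esub>"
      using h_torsion by (auto simp: torsion_submodule_def)
    have h0: "h 0 \<in> carrier ?Q"
      using h by (simp add: homology_def direct_sum_module_def)
    have rh0: "r \<odot>\<^bsub>?Q\<^esub> h 0 = \<zero>\<^bsub>?Q\<^esub>"
      using fun_cong[OF rh, of 0] by (simp add: homology_def direct_sum_module_def)
    obtain z where z: "z \<in> carrier ?C" "h 0 = {z}"
      using Q(1)[OF h0] Z by auto
    have rz: "r \<odot>\<^bsub>?C\<^esub> z = \<zero>\<^bsub>?C\<^esub>"
      using rh0 Q(3)[OF r(1) z(1)] Q(4) z(2) by simp
    have "z g = \<zero>\<^bsub>R\<^esub>" if g: "g \<in> generators D 0" for g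
    proof -
      have "r \<otimes>\<^bsub>R\<^esub> z g = \<zero>\<^bsub>R\<^esub>"
        using fun_cong[OF rz, of g] g by (simp add: chain_module_def free_module_def)
      then show ?thesis
        using integral r chain_apply_closed[OF z(1) g] by blast
    qed
    then have "z = \<zero>\<^bsub>?C\<^esub>"
      using z(1) by (auto simp: chain_module_def free_module_def fun_eq_iff PiE_iff extensional_def)
    then show ?thesis using z(2) by simp
  qed
  have alpha: "alpha_class R c D 0 = {alpha R c D}"
    using alpha_closed[OF assms(2), of D]
    by (simp add: alpha_class_def bound a_r_coset_def')
  have "k = 0"
    if divisible: "?T +>\<^bsub>?H\<^esub> alpha_class R c D
      \<in> (\<lambda>y. (c [^]\<^bsub>R\<^esub> k) \<odot>\<^bsub>homology_free R c D\<^esub> y) ` carrier (homology_free R c D)" for k :: nat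
  proof -
    have ck: "c [^]\<^bsub>R\<^esub> k \<in> carrier R" using assms(2) by simp
    have H_add: "(g \<oplus>\<^bsub>?H\<^esub> h) 0 = g 0 \<oplus>\<^bsub>?Q\<^esub> h 0" for g h
      by (simp add: homology_def direct_sum_module_def)
    have H_smult: "(a \<odot>\<^bsub>?H\<^esub> h) 0 = a \<odot>\<^bsub>?Q\<^esub> h 0" for a h
      by (simp add: homology_def direct_sum_module_def)
    \<comment> \<open>Here \<open>y\<close> represents a coset in \<open>homology_free\<close>; the
      union is the scalar multiplication of the quotient, unfolded.\<close>
    obtain y where y: "y \<in> carrier ?H"
      and eq: "?T +>\<^bsub>?H\<^esub> alpha_class R c D =
        (\<Union>x\<in>?T +>\<^bsub>?H\<^esub> y. ?T +>\<^bsub>?H\<^esub> (c [^]\<^bsub>R\<^esub> k \<odot>\<^bsub>?H\<^esub> x))"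
      using divisible by (auto simp: homology_free_def quot_module_def A_RCOSETS_def')
    \<comment> \<open>Zero is torsion, so this sum lies in the coset. On the other side of
      \<open>eq\<close>, \<open>t'\<close> comes from the coset of \<open>y\<close> and
      \<open>t\<close> from the outer coset.\<close>
    have "\<zero>\<^bsub>?H\<^esub> \<oplus>\<^bsub>?H\<^esub> alpha_class R c D \<in> ?T +>\<^bsub>?H\<^esub> alpha_class R c D"
      using homology_zero_in_torsion[OF assms(1,2), of D] by (auto simp: a_r_coset_def')
    then obtain t t' where t: "t \<in> ?T" "t' \<in> ?T"
      and "\<zero>\<^bsub>?H\<^esub> \<oplus>\<^bsub>?H\<^esub> alpha_class R c D =
        t \<oplus>\<^bsub>?H\<^esub> c [^]\<^bsub>R\<^esub> k \<odot>\<^bsub>?H\<^esub> (t' \<oplus>\<^bsub>?H\<^esub> y)"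
      unfolding eq by (auto simp: a_r_coset_def')
    from fun_cong[OF this(3), of 0]
    have eq0: "\<zero>\<^bsub>?H\<^esub> 0 \<oplus>\<^bsub>?Q\<^esub> {alpha R c D} =
        t 0 \<oplus>\<^bsub>?Q\<^esub> c [^]\<^bsub>R\<^esub> k \<odot>\<^bsub>?Q\<^esub> (t' 0 \<oplus>\<^bsub>?Q\<^esub> y 0)"
      by (simp add: H_add H_smult alpha)
    have "y 0 \<in> carrier ?Q"
      using y by (simp add: homology_def direct_sum_module_def)
    then obtain z where z: "z \<in> carrier ?C" "y 0 = {z}"
      using Q(1) Z by blast
    \<comment> \<open>The degree 0 components of \<open>t\<close>, \<open>t'\<close> and the zero of
      \<open>?H\<close> all vanish, which turns the identity of cosets into one of chains.\<close>
    have "alpha R c D = c [^]\<^bsub>R\<^esub> k \<odot>\<^bsub>?C\<^esub> z"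
      using eq0 torsion[OF t(1)] torsion[OF t(2)]
        torsion[OF homology_zero_in_torsion[OF assms(1,2)]] alpha_closed[OF assms(2), of D] z ck
      by (simp add: Q(2,3))
    then have unit: "c [^]\<^bsub>R\<^esub> k \<otimes>\<^bsub>R\<^esub> z ?X = \<one>\<^bsub>R\<^esub>"
      using alpha_all_X[OF X, of c] apply_smult[OF X] by simp
    show "k = 0"
    proof (rule ccontr)
      assume "k \<noteq> 0"
      \<comment> \<open>Splitting off one factor \<open>c\<close> from \<open>unit\<close> exhibits
        an inverse of \<open>c\<close>.\<close>
      then obtain j where "k = Suc j" by (cases k) auto
      then have "c \<otimes>\<^bsub>R\<^esub> (c [^]\<^bsub>R\<^esub> j \<otimes>\<^bsub>R\<^esub> z ?X) = \<one>\<^bsub>R\<^esub>"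
        using unit assms(2) chain_apply_closed[OF z(1) X] by (simp add: m_ac)
      then have "c \<in> Units R"
        using assms(2) chain_apply_closed[OF z(1) X]
        by (auto simp: Units_def m_comm intro!: bexI[of _ "c [^]\<^bsub>R\<^esub> j \<otimes>\<^bsub>R\<^esub> z ?X"])
      with assms(4) show False ..
    qed
  qed
  \<comment> \<open>Every admissible exponent is 0, hence so is the supremum in
    \<open>enat\<close>.\<close>
  then show ?thesis
    unfolding k_invariant_def divisibility_def
    by (intro order_antisym Sup_least zero_le) (fastforce simp: zero_enat_def)
qed

end
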